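(* Let $n$ be a positive integer. The total number of extremal arrays in $\mathcal{S}_{n,n+1}$ is exactly $n!\,(n+1)^{n-1}$.
   Context: An $n\times m$ real matrix $A=(a_{ij})$ is called a doubly stochastic array (with uniform marginals) if $a_{ij}\geq 0$ for all $i,j$, $\sum_{j=1}^m a_{ij}=m$ for every $1\leq i\leq n$, and $\sum_{i=1}^n a_{ij}=n$ for every $1\leq j\leq m$. The set of all such arrays is denoted $\mathcal{S}_{n,m}$; it is a convex polytope. An array $A\in\mathcal{S}_{n,m}$ is called extremal if it is an extreme point of $\mathcal{S}_{n,m}$, i.e. it cannot be represented as a convex combination of two other elements of $\mathcal{S}_{n,m}$ that are both different from $A$. *)

theory Defs
  imports "HOL-Analysis.Analysis"
begin

text \<open>
  A real array with \<open>n\<close> rows and \<open>m\<close> columns is an element of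
  \<open>real ^ 'm ^ 'n\<close> with \<open>n = CARD('n)\<close> and \<open>m = CARD('m)\<close>; its entry in row
  \<open>i\<close> and column \<open>j\<close> is \<open>A $ i $ j\<close>.
\<close>

definition doubly_stochastic_arrays :: "(real ^ 'm ^ 'n) set" where
  "doubly_stochastic_arrays =
     {A. (\<forall>i j. 0 \<le> A $ i $ j) \<and>
         (\<forall>i. (\<Sum>j\<in>UNIV. A $ i $ j) = real CARD('m)) \<and>
         (\<forall>j. (\<Sum>i\<in>UNIV. A $ i $ j) = real CARD('n))}"

definition extremal_arrays :: "(real ^ 'm ^ 'n) set" where
  "extremal_arrays = {A. A extreme_point_of doubly_stochastic_arrays}"

end

theory Submission imports Defs begin

text \<open>
  The extremal arrays with \<open>n\<close> rows and \<open>n + 1\<close> columns are the trees on the set of columns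
  whose edges are labelled bijectively by the rows.

  An array is an extreme point exactly when no nonzero balanced array (all row and column
  sums zero) lives on its support (\<open>extremal_iff_no_balanced_perturbation\<close>).  The row and column sums obey
  one linear relation, so they have rank at most \<open>n + (n + 1) - 1 = 2 n\<close>, and an extremal array
  has at most \<open>2 n\<close> nonzero entries.  On the other hand an entry is at most its column sum \<open>n\<close>,
  which is less than the row sum \<open>n + 1\<close>, so each row has at least two nonzero entries.  Hence
  each row of an extremal array has exactly two (\<open>extremal_row_support_card\<close>), and the row can be
  read as an edge between two columns.  Because \<open>n\<close> and \<open>n + 1\<close> are coprime, no proper nonempty
  set of columns can be closed under these edges (\<open>array_connects_columns\<close>): the \<open>n\<close> edges connect
  all \<open>n + 1\<close> columns and form a tree (\<open>extremal_has_tree_support\<close>).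

  Conversely, an edge-labelled tree carries exactly one array.  Removing the edge of a row splits
  the columns into two parts, and the entry at either endpoint must be the size of the part on the
  other side; these sizes do give the right row and column sums (\<open>tree_array_exists\<close>).  Balanced
  arrays supported by a tree vanish by elimination of leaves (\<open>tree_supported_balanced_zero\<close>),
  which gives both uniqueness and extremality.

  To count the trees, fix a root column.  A tree becomes a parent function on the other columns,
  and the edge labelling becomes a bijection from the other columns to the rows, a column
  being matched with the edge to its parent.  There are \<open>n!\<close> bijections, and \<open>(n + 1) ^ (n - 1)\<close>
  parent functions by Cayley's formula (\<open>card_rooted_forests\<close>).
\<close>

section \<open>Cayley's formula for rooted forests\<close>

text \<open>
  Forests on \<open>M \<union> K\<close> with root set \<open>K\<close>, given by their parent functions.  Acyclicity is expressed
  by the absence of nonempty invariant sets: in the finite case a nonempty invariant set contains a cycle.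
  In this form the condition passes to subsets of \<open>M\<close> unchanged, and it is literally an induction
  principle.
\<close>
definition rooted_forests :: "'a set \<Rightarrow> 'a set \<Rightarrow> ('a \<Rightarrow> 'a) set" where
  "rooted_forests M K = {p \<in> M \<rightarrow>\<^sub>E (M \<union> K). \<forall>S\<subseteq>M. p ` S \<subseteq> S \<longrightarrow> S = {}}"

lemma rooted_forestsD:
  assumes "p \<in> rooted_forests M K"
  shows "x \<in> M \<Longrightarrow> p x \<in> M \<union> K" and "S \<subseteq> M \<Longrightarrow> p ` S \<subseteq> S \<Longrightarrow> S = {}"
    and "p \<in> extensional M"
  using assms by (auto simp: rooted_forests_def PiE_iff)

lemma finite_rooted_forests:
  assumes "finite M" "finite K"
  shows "finite (rooted_forests M K)"
  unfolding rooted_forests_def using assms by (auto intro!: finite_PiE)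

text \<open>
  Cutting off the first layer: the set \<open>J\<close> of children of the roots, an arbitrary assignment of
  roots to these children, and a forest on the remaining vertices rooted at \<open>J\<close>.  The two
  acyclicity conditions agree because an invariant subset of \<open>M\<close> cannot meet \<open>J\<close>, whose
  elements have their parents outside \<open>M\<close>.
\<close>
lemma rooted_forests_layer_bij:
  assumes disj: "M \<inter> K = {}"
  shows "bij_betw (\<lambda>p. ({x\<in>M. p x \<in> K}, restrict p {x\<in>M. p x \<in> K}, restrict p {x\<in>M. p x \<notin> K}))
           (rooted_forests M K)
           (SIGMA J:Pow M. (J \<rightarrow>\<^sub>E K) \<times> rooted_forests (M - J) J)"
    (is "bij_betw ?enc ?F ?D")
proof (rule bij_betw_byWitness[where f' = "\<lambda>(J, g, h). \<lambda>x. if x \<in> J then g x else h x"], goal_cases)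
  case 1
  show ?case
    by (auto simp: fun_eq_iff extensional_def dest!: rooted_forestsD(3))
next
  case 2
  show ?case
  proof (rule ballI)
    fix t assume "t \<in> ?D"
    then obtain J g h where t: "t = (J, g, h)" and J: "J \<subseteq> M"
      and gE: "g \<in> J \<rightarrow>\<^sub>E K" and hF: "h \<in> rooted_forests (M - J) J"
      by auto
    let ?p = "\<lambda>x. if x \<in> J then g x else h x"
    have h: "h x \<in> M" if "x \<in> M" "x \<notin> J" for x
      using rooted_forestsD(1)[OF hF, of x] J that by auto
    have *: "?p x \<in> K \<longleftrightarrow> x \<in> J" if "x \<in> M" for x
      using that h[of x] gE disj by (auto simp: PiE_iff)
    have layer: "{x\<in>M. ?p x \<in> K} = J" "{x\<in>M. ?p x \<notin> K} = M - J"
      using * J by blast+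
    have "restrict ?p J = g" "restrict ?p (M - J) = h"
      using gE rooted_forestsD(3)[OF hF] by (auto simp: fun_eq_iff PiE_iff extensional_def)
    then show "?enc (case t of (J, g, h) \<Rightarrow> \<lambda>x. if x \<in> J then g x else h x) = t"
      unfolding t prod.case layer by simp
  qed
next
  case 3
  show ?case
  proof (rule image_subsetI)
    fix p assume p: "p \<in> ?F"
    let ?J = "{x\<in>M. p x \<in> K}"
    have 1: "restrict p ?J \<in> ?J \<rightarrow>\<^sub>E K" by auto
    have "restrict p {x\<in>M. p x \<notin> K} \<in> rooted_forests (M - ?J) ?J"
      unfolding rooted_forests_def
    proof (intro CollectI conjI allI impI)
      show "restrict p {x\<in>M. p x \<notin> K} \<in> (M - ?J) \<rightarrow>\<^sub>E (M - ?J) \<union> ?J"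
        using rooted_forestsD(1)[OF p] by (auto simp: PiE_iff extensional_def)
      fix S assume S: "S \<subseteq> M - ?J" "restrict p {x\<in>M. p x \<notin> K} ` S \<subseteq> S"
      then have "p ` S \<subseteq> S" by (force simp: image_subset_iff)
      then show "S = {}" using rooted_forestsD(2)[OF p, of S] S by blast
    qed
    with 1 show "?enc p \<in> ?D" by auto
  qed
next
  case 4
  show ?case
  proof (rule image_subsetI, clarify)
    fix J g h assume J: "J \<subseteq> M" and g: "g \<in> J \<rightarrow>\<^sub>E K" and h: "h \<in> rooted_forests (M - J) J"
    let ?p = "\<lambda>x. if x \<in> J then g x else h x"
    show "?p \<in> rooted_forests M K"
      unfolding rooted_forests_def
    proof (intro CollectI conjI allI impI)
      show "?p \<in> M \<rightarrow>\<^sub>E M \<union> K"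
        using J g rooted_forestsD(1,3)[OF h] by (auto simp: PiE_iff extensional_def)
      fix S assume S: "S \<subseteq> M" "?p ` S \<subseteq> S"
      have SJ: "S \<subseteq> M - J"
      proof
        fix x assume x: "x \<in> S"
        with S have "?p x \<in> M" by blast
        with x S g disj show "x \<in> M - J" by (auto simp: PiE_iff split: if_splits)
      qed
      have "h ` S \<subseteq> S" using S SJ by (force simp: image_subset_iff)
      then show "S = {}" using rooted_forestsD(2)[OF h SJ] by blast
    qed
  qed
qed

lemma sum_over_subsets_by_card:
  fixes f :: "nat \<Rightarrow> 'b::semiring_1"
  assumes "finite M"
  shows "(\<Sum>J\<in>Pow M. f (card J)) = (\<Sum>j\<le>card M. of_nat (card M choose j) * f j)"
proof -
  have "(\<Sum>J\<in>Pow M. f (card J)) = (\<Sum>j\<le>card M. \<Sum>J\<in>{J\<in>Pow M. card J = j}. f (card J))"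
    by (rule sum.group[symmetric]) (use assms in \<open>auto intro: card_mono\<close>)
  also have "\<dots> = (\<Sum>j\<le>card M. of_nat (card M choose j) * f j)"
    using n_subsets[OF assms] by (intro sum.cong) auto
  finally show ?thesis .
qed

text \<open>
  The derivative-like factor \<open>j\<close> is absorbed by \<open>j (m + 1 choose j) = (m + 1) (m choose j - 1)\<close>;
  what remains is the binomial theorem.
\<close>
lemma sum_binomial_weighted:
  fixes k :: nat
  shows "(\<Sum>j\<le>Suc m. (Suc m choose j) * (k ^ j * (j * Suc m ^ (Suc m - j)))) = Suc m * (k * (k + Suc m) ^ m)"
proof -
  have "(\<Sum>j\<le>Suc m. (Suc m choose j) * (k ^ j * (j * Suc m ^ (Suc m - j))))
      = (\<Sum>j\<le>m. (Suc j * (Suc m choose Suc j)) * (k * k ^ j * Suc m ^ (m - j)))"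
    by (subst sum.atMost_Suc_shift) (simp add: algebra_simps del: binomial_Suc_Suc)
  also have "\<dots> = Suc m * (k * (\<Sum>j\<le>m. (m choose j) * k ^ j * Suc m ^ (m - j)))"
    unfolding Suc_times_binomial sum_distrib_left by (simp add: mult_ac del: mult_Suc)
  finally show ?thesis using binomial[of k "Suc m" m] by simp
qed

text \<open>
  Cayley's formula for \<open>m\<close> vertices and \<open>k\<close> roots, \<open>k (k + m) ^ (m - 1)\<close>, by induction along the
  first layer.  The induction needs arbitrary root sets because the first layer becomes the
  root set of the rest.
\<close>
lemma card_rooted_forests:
  assumes "finite M" "finite K" "M \<inter> K = {}" "M \<noteq> {}"
  shows "card (rooted_forests M K) = card K * (card K + card M) ^ (card M - 1)"
  using assms
proof (induction "card M" arbitrary: M K rule: less_induct)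
  case less
  let ?m = "card M" and ?k = "card K"
  have m: "?m > 0" using less by (simp add: card_gt_0_iff)
  \<comment> \<open>Multiplying by \<open>?m\<close> gives one formula for every layer, including the full layer \<open>J = M\<close>,
      where the exponent of the induction hypothesis would be \<open>- 1\<close>.\<close>
  have layer: "?m * card (rooted_forests (M - J) J) = card J * ?m ^ (?m - card J)"
    if J: "J \<subseteq> M" for J
  proof -
    have fJ: "finite J" using J less(2) finite_subset by blast
    have cM: "card (M - J) = ?m - card J" "card J \<le> ?m"
      using J less(2) fJ by (auto simp: card_Diff_subset card_mono)
    consider "J = {}" | "J = M" | "J \<noteq> {}" "M - J \<noteq> {}" using J by blast
    then show ?thesis
    proof cases
      case 1
      have "rooted_forests M {} = {}"
        using less(5) by (auto simp: rooted_forests_def)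
      then show ?thesis using 1 by simp
    next
      case 2
      have "rooted_forests {} M = {\<lambda>_. undefined}" by (auto simp: rooted_forests_def)
      then show ?thesis using 2 by simp
    next
      case 3
      have c0: "card J > 0" using 3 fJ by (simp add: card_gt_0_iff)
      have c1: "card (M - J) > 0" using 3 less(2) by (simp add: card_gt_0_iff)
      have "card (rooted_forests (M - J) J) = card J * (card J + card (M - J)) ^ (card (M - J) - 1)"
        by (rule less(1)) (use 3 c0 cM m less(2) fJ in auto)
      also have "card J + card (M - J) = ?m" using cM by simp
      finally have "?m * card (rooted_forests (M - J) J) = card J * (?m * ?m ^ (card (M - J) - 1))"
        by simp
      also have "?m * ?m ^ (card (M - J) - 1) = ?m ^ (?m - card J)"
        using c1 unfolding cM(1) by (metis power_eq_if not_gr_zero)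
      finally show ?thesis .
    qed
  qed
  have "card (rooted_forests M K)
      = card (SIGMA J:Pow M. (J \<rightarrow>\<^sub>E K) \<times> rooted_forests (M - J) J)"
    by (rule bij_betw_same_card[OF rooted_forests_layer_bij[OF less(4)]])
  also have "\<dots> = (\<Sum>J\<in>Pow M. card ((J \<rightarrow>\<^sub>E K) \<times> rooted_forests (M - J) J))"
    using less(2,3) by (intro card_SigmaI ballI finite_cartesian_product finite_PiE finite_rooted_forests)
      (auto intro: finite_subset)
  also have "\<dots> = (\<Sum>J\<in>Pow M. ?k ^ card J * card (rooted_forests (M - J) J))"
    using less(2) by (intro sum.cong) (auto simp: card_cartesian_product card_PiE finite_subset)
  finally have "?m * card (rooted_forests M K)
      = (\<Sum>J\<in>Pow M. ?k ^ card J * (?m * card (rooted_forests (M - J) J)))"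
    by (simp add: sum_distrib_left mult_ac)
  also have "\<dots> = (\<Sum>J\<in>Pow M. ?k ^ card J * (card J * ?m ^ (?m - card J)))"
    using layer by (intro sum.cong) auto
  also have "\<dots> = (\<Sum>j\<le>?m. (?m choose j) * (?k ^ j * (j * ?m ^ (?m - j))))"
    using sum_over_subsets_by_card[OF less(2), of "\<lambda>j. ?k ^ j * (j * ?m ^ (?m - j))"] by simp
  also have "\<dots> = ?m * (?k * (?k + ?m) ^ (?m - 1))"
    using sum_binomial_weighted[of "?m - 1" ?k] m by simp
  finally show ?case using m by simp
qed

section \<open>Induction on rooted forests\<close>

text \<open>
  Induction from the roots to the leaves: the set of counterexamples is invariant under \<open>p\<close>.
\<close>
lemma rooted_forest_root_induct:
  assumes p: "p \<in> rooted_forests M K" and "v \<in> M"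
    and step: "\<And>v. v \<in> M \<Longrightarrow> (p v \<in> M \<Longrightarrow> P (p v)) \<Longrightarrow> P v"
  shows "P v"
proof -
  have "{v\<in>M. \<not> P v} = {}"
    by (rule rooted_forestsD(2)[OF p]) (use step in blast)+
  then show ?thesis using \<open>v \<in> M\<close> by blast
qed

text \<open>
  Induction from the leaves to the roots.  Every counterexample is the parent of another
  counterexample in \<open>M\<close>; by counting, the finite set \<open>S\<close> of counterexamples then lies in \<open>M\<close> and is
  mapped onto itself by \<open>p\<close>, so it is an invariant set.
\<close>
lemma rooted_forest_leaf_induct:
  assumes p: "p \<in> rooted_forests M K" and fin: "finite M" "finite K" and v: "v \<in> M \<union> K"
    and step: "\<And>v. v \<in> M \<union> K \<Longrightarrow> (\<And>w. w \<in> M \<Longrightarrow> p w = v \<Longrightarrow> P w) \<Longrightarrow> P v"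
  shows "P v"
proof -
  define S where "S = {v \<in> M \<union> K. \<not> P v}"
  have fS: "finite S" unfolding S_def using fin by auto
  have sub: "S \<subseteq> p ` (S \<inter> M)" unfolding S_def using step by blast
  have "card S \<le> card (p ` (S \<inter> M))" using sub fS by (intro card_mono) auto
  also have "\<dots> \<le> card (S \<inter> M)" using fS by (intro card_image_le) auto
  finally have "S \<inter> M = S" using fS by (intro card_seteq) auto
  moreover from this have "p ` S = S"
    using sub fS card_image_le[OF fS, of p] by (metis card_seteq finite_imageI)
  ultimately have "S = {}" using rooted_forestsD(2)[OF p, of S] by auto
  then show ?thesis using v unfolding S_def by blast
qed

lemma rooted_forest_parent_neq:
  assumes "p \<in> rooted_forests M K" "v \<in> M"
  shows "p v \<noteq> v"
  using rooted_forestsD(2)[OF assms(1), of "{v}"] assms(2) by auto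

text \<open>
  \<open>D v\<close> is the number of vertices in the subtree below \<open>v\<close>, with \<open>v\<close> included.  Only the recursion
  and the resulting bounds matter, so \<open>D\<close> is obtained as a solution of the linear system
  \<open>D v - (\<Sum>w child of v. D w) = 1\<close>: the system is triangular with respect to the tree, hence
  injective by induction from the leaves, hence solvable.
\<close>
lemma subtree_sizes_exist:
  fixes \<rho> :: "'m::finite"
  assumes p: "p \<in> rooted_forests (- {\<rho>}) {\<rho>}"
  obtains D :: "'m \<Rightarrow> real" where
    "\<And>v. D v = 1 + (\<Sum>w | w \<noteq> \<rho> \<and> p w = v. D w)" "\<And>v. 0 < D v"
    "D \<rho> = real CARD('m)" "\<And>v. v \<noteq> \<rho> \<Longrightarrow> D v < real CARD('m)"
proof -
  let ?ch = "\<lambda>v. {w. w \<noteq> \<rho> \<and> p w = v}"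
  define f :: "real^'m \<Rightarrow> real^'m" where "f x = (\<chi> v. x $ v - (\<Sum>w\<in>?ch v. x $ w))" for x
  have lin: "linear f"
    by (rule linearI) (simp_all add: f_def vec_eq_iff sum.distrib sum_distrib_left algebra_simps)
  have "inj f"
  proof (subst linear_injective_0[OF lin], intro allI impI)
    fix x assume "f x = 0"
    then have x: "x $ v = (\<Sum>w\<in>?ch v. x $ w)" for v
    proof -
      have "f x $ v = 0" using \<open>f x = 0\<close> by simp
      then show ?thesis by (simp add: f_def)
    qed
    have "x $ v = 0" for v
    proof (rule rooted_forest_leaf_induct[OF p, where P = "\<lambda>v. x $ v = 0"])
      fix v assume "\<And>w. w \<in> - {\<rho>} \<Longrightarrow> p w = v \<Longrightarrow> x $ w = 0"
      then have "(\<Sum>w\<in>?ch v. x $ w) = 0" by (intro sum.neutral) auto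
      then show "x $ v = 0" by (subst x)
    qed auto
    then show "x = 0" by (simp add: vec_eq_iff)
  qed
  then have "surj f" by (rule linear_injective_imp_surjective[OF lin]) simp
  then obtain x where fx: "f x = (\<chi> v. 1)" by (metis surjD)
  define D where "D v = x $ v" for v
  have D: "D v = 1 + (\<Sum>w\<in>?ch v. D w)" for v
    using arg_cong[OF fx, of "\<lambda>y. y $ v"] by (simp add: f_def D_def algebra_simps)
  have pos: "0 < D v" for v
  proof (rule rooted_forest_leaf_induct[OF p, where P = "\<lambda>v. 0 < D v"])
    fix v assume "\<And>w. w \<in> - {\<rho>} \<Longrightarrow> p w = v \<Longrightarrow> 0 < D w"
    then have "0 \<le> (\<Sum>w\<in>?ch v. D w)" by (intro sum_nonneg) (auto simp: less_imp_le)
    then show "0 < D v" using D[of v] by linarith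
  qed auto
  \<comment> \<open>Summing the recursion over all vertices counts every vertex but the root once as a child,
      which leaves the value at the root.\<close>
  have "(\<Sum>v\<in>UNIV. D v) = (\<Sum>v\<in>UNIV. 1 + (\<Sum>w\<in>?ch v. D w))"
    by (rule sum.cong[OF refl D])
  also have "\<dots> = real CARD('m) + (\<Sum>v\<in>UNIV. \<Sum>w\<in>?ch v. D w)" by (simp add: sum.distrib)
  also have "(\<Sum>v\<in>UNIV. \<Sum>w\<in>?ch v. D w) = (\<Sum>w\<in>- {\<rho>}. D w)"
    using sum.group[of "- {\<rho>}" UNIV p D] by simp
  also have "(\<Sum>v\<in>UNIV. D v) = D \<rho> + (\<Sum>w\<in>- {\<rho>}. D w)"
    using sum.remove[of UNIV \<rho> D] unfolding Compl_eq_Diff_UNIV by simp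
  finally have root: "D \<rho> = real CARD('m)" by simp
  have mono: "D v < D (p v)" if "v \<noteq> \<rho>" for v
  proof -
    have "D v \<le> (\<Sum>w\<in>?ch (p v). D w)"
      by (rule member_le_sum) (use that pos in \<open>auto simp: less_imp_le\<close>)
    then show ?thesis using D[of "p v"] by linarith
  qed
  have "D v < real CARD('m)" if "v \<noteq> \<rho>" for v
  proof (rule rooted_forest_root_induct[OF p, where P = "\<lambda>v. D v < real CARD('m)"])
    fix v assume "v \<in> - {\<rho>}" "p v \<in> - {\<rho>} \<Longrightarrow> D (p v) < real CARD('m)"
    then show "D v < real CARD('m)" using mono[of v] root by (cases "p v = \<rho>") auto
  qed (use that in auto)
  with D pos root show thesis using that by blast
qed

section \<open>Extreme points and balanced perturbations\<close>

definition balanced :: "real^'m^'n \<Rightarrow> bool" where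
  "balanced X \<longleftrightarrow> (\<forall>i. (\<Sum>j\<in>UNIV. X $ i $ j) = 0) \<and> (\<forall>j. (\<Sum>i\<in>UNIV. X $ i $ j) = 0)"

lemma balanced_diff:
  assumes "A \<in> doubly_stochastic_arrays" "B \<in> doubly_stochastic_arrays"
  shows "balanced (A - B)"
  using assms by (simp add: balanced_def doubly_stochastic_arrays_def sum_subtractf)

text \<open>
  A balanced \<open>X\<close> on the support of \<open>A\<close> makes \<open>A\<close> the midpoint of \<open>A + \<epsilon> X\<close> and \<open>A - \<epsilon> X\<close>, which are
  nonnegative for small \<open>\<epsilon>\<close>.  Conversely, if \<open>A\<close> lies strictly between \<open>B\<close> and \<open>C\<close>, both must vanish
  wherever \<open>A\<close> does, and \<open>B - C\<close> is a balanced array on the support of \<open>A\<close>.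
\<close>
lemma extremal_iff_no_balanced_perturbation:
  fixes A :: "real^'m^'n"
  assumes A: "A \<in> doubly_stochastic_arrays"
  shows "A \<in> extremal_arrays \<longleftrightarrow>
    (\<forall>X. balanced X \<longrightarrow> (\<forall>i j. A $ i $ j = 0 \<longrightarrow> X $ i $ j = 0) \<longrightarrow> X = 0)"
proof (intro iffI allI impI)
  fix X :: "real^'m^'n"
  assume ext: "A \<in> extremal_arrays" and X: "balanced X"
    and supp: "\<forall>i j. A $ i $ j = 0 \<longrightarrow> X $ i $ j = 0"
  define P where "P = {(i, j). A $ i $ j > 0}"
  \<comment> \<open>\<open>\<delta>\<close> bounds the positive entries from below; the extra element \<open>1\<close> only keeps the set
      nonempty.  Dividing by \<open>1 + norm X\<close> makes every entry of \<open>\<epsilon> X\<close> at most \<open>\<delta>\<close>.\<close>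
  define \<delta> where "\<delta> = Min (insert 1 ((\<lambda>(i, j). A $ i $ j) ` P))"
  have \<delta>: "\<delta> > 0" unfolding \<delta>_def by (subst Min_gr_iff) (auto simp: P_def)
  have \<delta>_le: "\<delta> \<le> A $ i $ j" if "A $ i $ j > 0" for i j
    unfolding \<delta>_def by (rule Min_le) (use that in \<open>auto simp: P_def intro!: image_eqI[of _ _ "(i, j)"]\<close>)
  define \<epsilon> where "\<epsilon> = \<delta> / (1 + norm X)"
  have \<epsilon>: "\<epsilon> > 0" unfolding \<epsilon>_def using \<delta> by (intro divide_pos_pos) (auto intro: add_pos_nonneg)
  have small: "\<bar>\<epsilon> * X $ i $ j\<bar> \<le> A $ i $ j" for i j
  proof (cases "A $ i $ j = 0")
    case False
    then have pos: "A $ i $ j > 0" using A by (auto simp: doubly_stochastic_arrays_def less_le)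
    have "\<bar>X $ i $ j\<bar> \<le> norm (X $ i)" using component_le_norm_cart[of "X $ i" j] .
    also have "\<dots> \<le> norm X" by (rule Finite_Cartesian_Product.norm_nth_le)
    finally have "\<epsilon> * \<bar>X $ i $ j\<bar> \<le> \<epsilon> * (1 + norm X)" using \<epsilon> by (intro mult_left_mono) auto
    also have "\<dots> = \<delta>"
      using add_pos_nonneg[OF zero_less_one norm_ge_zero[of X]] by (simp add: \<epsilon>_def)
    also have "\<dots> \<le> A $ i $ j" using \<delta>_le[OF pos] .
    finally show ?thesis using \<epsilon> by (simp add: abs_mult)
  qed (use supp in auto)
  have mem: "A + c *\<^sub>R X \<in> doubly_stochastic_arrays" if "\<bar>c\<bar> = \<epsilon>" for c
  proof -
    have "0 \<le> A $ i $ j + c * X $ i $ j" for i j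
      using small[of i j] that \<epsilon> by (auto simp: abs_mult abs_if split: if_splits)
    then show ?thesis using A X
      by (auto simp: doubly_stochastic_arrays_def balanced_def sum.distrib sum_distrib_left[symmetric])
  qed
  have "A = midpoint (A + \<epsilon> *\<^sub>R X) (A + (- \<epsilon>) *\<^sub>R X)"
    by (simp add: midpoint_def scaleR_2[symmetric] algebra_simps)
  then have "A + \<epsilon> *\<^sub>R X \<noteq> A + (- \<epsilon>) *\<^sub>R X
      \<Longrightarrow> A \<in> open_segment (A + \<epsilon> *\<^sub>R X) (A + (- \<epsilon>) *\<^sub>R X)"
    using midpoint_in_open_segment[of "A + \<epsilon> *\<^sub>R X" "A + (- \<epsilon>) *\<^sub>R X"] by simp
  moreover have "A \<notin> open_segment (A + \<epsilon> *\<^sub>R X) (A + (- \<epsilon>) *\<^sub>R X)"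
    using ext mem[of \<epsilon>] mem[of "- \<epsilon>"] \<epsilon>
    unfolding extremal_arrays_def extreme_point_of_def mem_Collect_eq by simp
  ultimately have "A + \<epsilon> *\<^sub>R X = A + (- \<epsilon>) *\<^sub>R X" by blast
  then have "(2 * \<epsilon>) *\<^sub>R X = 0" by (simp add: vec_eq_iff)
  then show "X = 0" using \<epsilon> by simp
next
  assume triv: "\<forall>X. balanced X \<longrightarrow> (\<forall>i j. A $ i $ j = 0 \<longrightarrow> X $ i $ j = 0) \<longrightarrow> X = 0"
  show "A \<in> extremal_arrays"
    unfolding extremal_arrays_def extreme_point_of_def mem_Collect_eq
  proof (intro conjI ballI notI A)
    fix B C :: "real^'m^'n"
    assume B: "B \<in> doubly_stochastic_arrays" and C: "C \<in> doubly_stochastic_arrays"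
      and "A \<in> open_segment B C"
    then obtain u where neq: "B \<noteq> C" and u: "0 < u" "u < 1" and Au: "A = (1 - u) *\<^sub>R B + u *\<^sub>R C"
      by (auto simp: in_segment)
    have Z: "B $ i $ j = 0 \<and> C $ i $ j = 0" if "A $ i $ j = 0" for i j
    proof -
      have nn: "0 \<le> B $ i $ j" "0 \<le> C $ i $ j"
        using B C by (auto simp: doubly_stochastic_arrays_def)
      have "(1 - u) * B $ i $ j + u * C $ i $ j = 0" using that Au by simp
      then show ?thesis using nn u by (simp add: add_nonneg_eq_0_iff)
    qed
    have "B - C = 0" by (rule triv[rule_format, OF balanced_diff[OF B C]]) (simp add: Z)
    with neq show False by simp
  qed
qed

section \<open>Arrays supported by a tree\<close>

text \<open>
  Row \<open>r v\<close> is the edge from column \<open>v\<close> to its parent \<open>p v\<close>; the root \<open>\<rho>\<close> has no such edge.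
\<close>
definition has_tree_support :: "real^'m^'n \<Rightarrow> 'm \<Rightarrow> ('m \<Rightarrow> 'n) \<Rightarrow> ('m \<Rightarrow> 'm) \<Rightarrow> bool" where
  "has_tree_support A \<rho> r p \<longleftrightarrow> (\<forall>v j. v \<noteq> \<rho> \<longrightarrow> (A $ r v $ j \<noteq> 0 \<longleftrightarrow> j = v \<or> j = p v))"

lemma sum_two_point_support:
  fixes g :: "'a::finite \<Rightarrow> real"
  assumes "a \<noteq> b" "\<And>j. j \<noteq> a \<Longrightarrow> j \<noteq> b \<Longrightarrow> g j = 0"
  shows "(\<Sum>j\<in>UNIV. g j) = g a + g b"
proof -
  have "(\<Sum>j\<in>UNIV. g j) = (\<Sum>j\<in>{a, b}. g j)"
    by (rule sum.mono_neutral_right) (use assms in auto)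
  then show ?thesis using assms(1) by simp
qed

text \<open>
  In row \<open>r v\<close> the entries at \<open>v\<close> and at \<open>p v\<close> are opposite.  If all children of \<open>v\<close> have entry zero
  in their rows, the sum of column \<open>v\<close> reduces to the single entry in row \<open>r v\<close>, which is then
  zero as well; so induction from the leaves applies.
\<close>
lemma tree_supported_balanced_zero:
  fixes X :: "real^'m^'n"
  assumes p: "p \<in> rooted_forests (- {\<rho>}) {\<rho>}" and r: "bij_betw r (- {\<rho>}) UNIV"
    and supp: "\<And>v j. v \<noteq> \<rho> \<Longrightarrow> j \<noteq> v \<Longrightarrow> j \<noteq> p v \<Longrightarrow> X $ r v $ j = 0"
    and X: "balanced X"
  shows "X = 0"
proof -
  have row: "X $ r v $ p v = - X $ r v $ v" if "v \<noteq> \<rho>" for v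
  proof -
    have "(\<Sum>j\<in>UNIV. X $ r v $ j) = X $ r v $ v + X $ r v $ p v"
      by (rule sum_two_point_support) (use rooted_forest_parent_neq[OF p, of v, THEN not_sym] supp that in auto)
    then show ?thesis using X by (simp add: balanced_def)
  qed
  have col: "(\<Sum>w\<in>- {\<rho>}. X $ r w $ j) = 0" for j
    using sum.reindex_bij_betw[OF r, of "\<lambda>i. X $ i $ j"] X by (simp add: balanced_def)
  have zero: "v \<noteq> \<rho> \<longrightarrow> X $ r v $ v = 0" for v
  proof (rule rooted_forest_leaf_induct[OF p, where P = "\<lambda>v. v \<noteq> \<rho> \<longrightarrow> X $ r v $ v = 0"], goal_cases)
    case (4 v)
    show ?case
    proof
      assume v: "v \<noteq> \<rho>"
      have "X $ r w $ v = 0" if "w \<in> - {\<rho>} - {v}" for w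
        using that 4(2)[of w] row[of w] supp[of w v] by (cases "p w = v") auto
      then have "(\<Sum>w\<in>- {\<rho>} - {v}. X $ r w $ v) = 0" by (intro sum.neutral) auto
      then show "X $ r v $ v = 0"
        using col[of v] sum.remove[of "- {\<rho>}" v "\<lambda>w. X $ r w $ v"] v by simp
    qed
  qed auto
  have "X $ r v $ j = 0" if "v \<noteq> \<rho>" for v j
    using zero[of v] row[of v] supp[of v j] that by (cases "j = v"; cases "j = p v") auto
  moreover have "\<exists>v. v \<noteq> \<rho> \<and> r v = i" for i
    using bij_betw_imp_surj_on[OF r] by (metis ComplD UNIV_I imageE singletonI)
  ultimately show "X = 0" unfolding vec_eq_iff by (metis zero_index)
qed

text \<open>
  The edge from \<open>v\<close> to its parent separates the \<open>D v\<close> columns below \<open>v\<close> from the others; each endpoint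
  receives the size of the opposite part.  Column \<open>v\<close> then collects the sizes of all
  branches at \<open>v\<close>, and these add up to the number of columns other than \<open>v\<close>.
\<close>
lemma tree_array_exists:
  assumes p: "p \<in> rooted_forests (- {\<rho>}) {\<rho>}" and r: "bij_betw r (- {\<rho>}) (UNIV :: 'n::finite set)"
    and card: "CARD('m::finite) = CARD('n) + 1"
  obtains A :: "real^'m^'n" where "A \<in> doubly_stochastic_arrays" "has_tree_support A \<rho> r p"
proof -
  obtain D :: "'m \<Rightarrow> real" where
    D: "\<And>v. D v = 1 + (\<Sum>w | w \<noteq> \<rho> \<and> p w = v. D w)" and pos: "\<And>v. 0 < D v"
    and root: "D \<rho> = real CARD('m)" and less: "\<And>v. v \<noteq> \<rho> \<Longrightarrow> D v < real CARD('m)"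
    using subtree_sizes_exist[OF p] by blast
  define c where "c = inv_into (- {\<rho>}) r"
  have cr: "c (r v) = v" if "v \<noteq> \<rho>" for v
    unfolding c_def using r that by (intro inv_into_f_f) (auto simp: bij_betw_def)
  have surj: "\<exists>v. v \<noteq> \<rho> \<and> r v = i" for i
    using bij_betw_imp_surj_on[OF r] by (metis ComplD UNIV_I imageE singletonI)
  define A :: "real^'m^'n" where
    "A = (\<chi> i j. (if j = c i then real CARD('m) - D (c i) else 0) + (if j = p (c i) then D (c i) else 0))"
  have A: "A $ r v $ j = (if j = v then real CARD('m) - D v else 0) + (if j = p v then D v else 0)"
    if "v \<noteq> \<rho>" for v j using that by (simp add: A_def cr)
  have neq: "p v \<noteq> v" if "v \<noteq> \<rho>" for v using rooted_forest_parent_neq[OF p] that by auto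
  have "0 \<le> A $ i $ j" for i j
    using surj[of i] A[of _ j] pos less by (auto simp: less_imp_le add_nonneg_nonneg)
  moreover have "(\<Sum>j\<in>UNIV. A $ i $ j) = real CARD('m)" for i
    using surj[of i] A by (auto simp: sum.distrib)
  moreover have "(\<Sum>i\<in>UNIV. A $ i $ j) = real CARD('n)" for j
  proof -
    have "(\<Sum>i\<in>UNIV. A $ i $ j) = (\<Sum>v\<in>- {\<rho>}. A $ r v $ j)"
      using sum.reindex_bij_betw[OF r, of "\<lambda>i. A $ i $ j"] by simp
    also have "\<dots> = (\<Sum>v\<in>- {\<rho>}. if j = v then real CARD('m) - D v else 0)
        + (\<Sum>v\<in>- {\<rho>}. if j = p v then D v else 0)"
      unfolding sum.distrib[symmetric] by (rule sum.cong) (use A in auto)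
    also have "(\<Sum>v\<in>- {\<rho>}. if j = v then real CARD('m) - D v else 0) = real CARD('m) - D j"
      using root by (simp add: sum.delta)
    also have "(\<Sum>v\<in>- {\<rho>}. if j = p v then D v else 0) = (\<Sum>w | w \<noteq> \<rho> \<and> p w = j. D w)"
      by (rule sum.mono_neutral_cong_right) auto
    also have "\<dots> = D j - 1" using D[of j] by linarith
    finally show ?thesis using card by simp
  qed
  ultimately have "A \<in> doubly_stochastic_arrays" by (simp add: doubly_stochastic_arrays_def)
  moreover have "has_tree_support A \<rho> r p"
    unfolding has_tree_support_def
  proof (intro allI impI)
    fix v j assume v: "v \<noteq> \<rho>"
    show "A $ r v $ j \<noteq> 0 \<longleftrightarrow> j = v \<or> j = p v"
      using A[OF v, of j] pos[of v] less[OF v] neq[OF v] by auto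
  qed
  ultimately show thesis using that by blast
qed

lemma tree_supported_extremal:
  fixes A :: "real^'m^'n"
  assumes "p \<in> rooted_forests (- {\<rho>}) {\<rho>}" "bij_betw r (- {\<rho>}) UNIV"
    and "A \<in> doubly_stochastic_arrays" "has_tree_support A \<rho> r p"
  shows "A \<in> extremal_arrays"
  unfolding extremal_iff_no_balanced_perturbation[OF assms(3)]
  using tree_supported_balanced_zero[OF assms(1,2)] assms(4) unfolding has_tree_support_def by metis

lemma tree_supported_array_unique:
  fixes A B :: "real^'m^'n"
  assumes "p \<in> rooted_forests (- {\<rho>}) {\<rho>}" "bij_betw r (- {\<rho>}) UNIV"
    and "A \<in> doubly_stochastic_arrays" "has_tree_support A \<rho> r p"
    and "B \<in> doubly_stochastic_arrays" "has_tree_support B \<rho> r p"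
  shows "A = B"
proof -
  have "A - B = 0"
    by (rule tree_supported_balanced_zero[OF assms(1,2) _ balanced_diff[OF assms(3,5)]])
       (use assms(4,6) in \<open>unfold has_tree_support_def, metis diff_self vector_minus_component\<close>)
  then show ?thesis by simp
qed

text \<open>
  The support fixes the undirected labelled tree, and the orientation towards a given root is then
  forced.  Going down from the root, suppose that the row \<open>r v\<close> were used in the second tree by
  its other endpoint \<open>p v\<close>; but \<open>p v\<close> already uses the row \<open>r (p v)\<close> there.
\<close>
lemma tree_determined_by_support:
  fixes A :: "real^'m^'n"
  assumes p: "p \<in> rooted_forests (- {\<rho>}) {\<rho>}" and r: "bij_betw r (- {\<rho>}) UNIV"
    and p': "p' \<in> rooted_forests (- {\<rho>}) {\<rho>}" and r': "bij_betw r' (- {\<rho>}) UNIV"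
    and S: "has_tree_support A \<rho> r p" and S': "has_tree_support A \<rho> r' p'"
    and v: "v \<noteq> \<rho>"
  shows "r v = r' v \<and> p v = p' v"
proof -
  have neq: "p v \<noteq> v" if "v \<noteq> \<rho>" for v using rooted_forest_parent_neq[OF p] that by auto
  have same: "r v = r' v" if "v \<noteq> \<rho>" for v
  proof (rule rooted_forest_root_induct[OF p, where P = "\<lambda>v. r v = r' v"])
    show "v \<in> - {\<rho>}" using that by simp
    fix v assume v: "v \<in> - {\<rho>}" and IH: "p v \<in> - {\<rho>} \<Longrightarrow> r (p v) = r' (p v)"
    obtain w where w: "w \<noteq> \<rho>" "r' w = r v"
      using bij_betw_imp_surj_on[OF r'] by (metis ComplD UNIV_I imageE singletonI)
    have "w = v \<or> w = p v"
      using S S' w v unfolding has_tree_support_def by (metis ComplD singletonI)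
    then show "r v = r' v"
    proof
      assume "w = p v"
      then have "r (p v) = r v" "p v \<in> - {\<rho>}" using IH w by auto
      then have "p v = v" using r v by (auto simp: bij_betw_def inj_on_def)
      with neq v show ?thesis by auto
    qed (use w in auto)
  qed
  have "p v = v \<or> p v = p' v"
    using S S' same[OF v] v unfolding has_tree_support_def by metis
  then show ?thesis using same[OF v] neq[OF v] by auto
qed

section \<open>The support of an extremal array is a tree\<close>

text \<open>
  If no row had entries both inside and outside \<open>S\<close>, then the rows meeting \<open>S\<close>, say \<open>t\<close> many, would
  have their entire mass in the columns of \<open>S\<close>, so \<open>t (n + 1) = card S * n\<close>.  By coprimality \<open>n + 1\<close>
  divides \<open>card S\<close>, which is impossible for \<open>0 < card S < n + 1\<close>.
\<close>
lemma array_connects_columns: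
  fixes A :: "real^'m^'n"
  assumes A: "A \<in> doubly_stochastic_arrays" and card: "CARD('m) = CARD('n) + 1"
    and S: "S \<noteq> {}" "S \<noteq> UNIV"
  shows "\<exists>i. \<exists>u\<in>S. \<exists>v\<in>-S. A $ i $ u \<noteq> 0 \<and> A $ i $ v \<noteq> 0"
proof (rule ccontr)
  assume "\<not> ?thesis"
  then have sep: "A $ i $ v = 0" if "u \<in> S" "v \<notin> S" "A $ i $ u \<noteq> 0" for i u v
    using that by blast
  define T where "T = {i. \<exists>u\<in>S. A $ i $ u \<noteq> 0}"
  have rows: "(\<Sum>u\<in>S. A $ i $ u) = (if i \<in> T then real CARD('m) else 0)" for i
  proof (cases "i \<in> T")
    case True
    then have "(\<Sum>u\<in>S. A $ i $ u) = (\<Sum>u\<in>UNIV. A $ i $ u)"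
      using sep unfolding T_def by (intro sum.mono_neutral_left) auto
    then show ?thesis using A True by (simp add: doubly_stochastic_arrays_def)
  next
    case False
    then show ?thesis by (auto simp: T_def)
  qed
  have "real (card S * CARD('n)) = (\<Sum>u\<in>S. \<Sum>i\<in>UNIV. A $ i $ u)"
    using A by (simp add: doubly_stochastic_arrays_def)
  also have "\<dots> = (\<Sum>i\<in>UNIV. \<Sum>u\<in>S. A $ i $ u)" by (rule sum.swap)
  also have "\<dots> = real (card T * CARD('m))" unfolding rows by (simp add: sum.If_cases)
  finally have "card S * CARD('n) = card T * CARD('m)" unfolding of_nat_eq_iff .
  then have "CARD('m) dvd card S * CARD('n)" by simp
  moreover have "coprime CARD('m) CARD('n)" unfolding card by simp
  ultimately have "CARD('m) dvd card S" by (simp add: coprime_dvd_mult_left_iff)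
  moreover have "0 < card S" using S by (simp add: card_gt_0_iff)
  moreover have "card S < CARD('m)" using S by (intro psubset_card_mono) auto
  ultimately show False using nat_dvd_not_less by blast
qed

lemma row_support_card_ge_2:
  fixes A :: "real^'m^'n"
  assumes A: "A \<in> doubly_stochastic_arrays" and card: "CARD('n) < CARD('m)"
  shows "2 \<le> card {j. A $ i $ j \<noteq> 0}"
proof (rule ccontr)
  assume "\<not> 2 \<le> card {j. A $ i $ j \<noteq> 0}"
  then have "card {j. A $ i $ j \<noteq> 0} \<le> 1" by simp
  then obtain j where j: "{j. A $ i $ j \<noteq> 0} \<subseteq> {j}"
    by (metis One_nat_def card_le_Suc0_iff_eq empty_subsetI finite subsetI singletonI subset_singletonD)
  have "real CARD('m) = (\<Sum>j\<in>UNIV. A $ i $ j)" using A by (simp add: doubly_stochastic_arrays_def)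
  also have "\<dots> = (\<Sum>j\<in>{j}. A $ i $ j)" by (rule sum.mono_neutral_right) (use j in auto)
  also have "\<dots> \<le> (\<Sum>i\<in>UNIV. A $ i $ j)"
    using A member_le_sum[of i UNIV "\<lambda>i. A $ i $ j"] by (simp add: doubly_stochastic_arrays_def)
  also have "\<dots> = real CARD('n)" using A by (simp add: doubly_stochastic_arrays_def)
  finally show False using card by simp
qed

text \<open>
  By extremality, the map to row and column sums is injective on the arrays supported in \<open>E\<close>,
  a space of dimension \<open>card E\<close>.  Its values lie in a hyperplane, since the row sums and the
  column sums have the same total.
\<close>
lemma extremal_support_card_le:
  fixes A :: "real^'m^'n"
  assumes ext: "A \<in> extremal_arrays"
  shows "card {(i, j). A $ i $ j \<noteq> 0} \<le> CARD('n) + CARD('m) - 1"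
proof -
  have A: "A \<in> doubly_stochastic_arrays"
    using ext by (simp add: extremal_arrays_def extreme_point_of_def)
  define E where "E = {(i, j). A $ i $ j \<noteq> 0}"
  define b :: "'n \<times> 'm \<Rightarrow> real^'m^'n" where "b = (\<lambda>(i, j). axis i (axis j 1))"
  have injb: "inj b" by (auto simp: inj_def b_def axis_eq_axis)
  have "b ` E \<subseteq> Basis" by (auto simp: b_def axis_in_Basis_iff)
  then have indep: "independent (b ` E)" using independent_Basis independent_mono by blast
  define f :: "real^'m^'n \<Rightarrow> (real^'n) \<times> (real^'m)"
    where "f X = ((\<chi> i. \<Sum>j\<in>UNIV. X $ i $ j), (\<chi> j. \<Sum>i\<in>UNIV. X $ i $ j))" for X
  have lin: "linear f"
    by (rule linearI) (simp_all add: f_def vec_eq_iff sum.distrib sum_distrib_left)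
  have supp: "\<forall>i j. A $ i $ j = 0 \<longrightarrow> X $ i $ j = 0" if "X \<in> span (b ` E)" for X
    using that
  proof (induction rule: span_induct)
    case base
    show ?case by (auto simp: subspace_def)
  next
    case (step X)
    then show ?case by (auto simp: b_def E_def axis_def)
  qed
  have inj: "inj_on f (span (b ` E))"
    unfolding linear_injective_on_subspace_0[OF lin subspace_span]
  proof (intro ballI impI)
    fix X assume X: "X \<in> span (b ` E)" "f X = 0"
    then have "balanced X" by (simp add: f_def balanced_def vec_eq_iff zero_prod_def)
    then show "X = 0"
      using ext supp[OF X(1)] unfolding extremal_iff_no_balanced_perturbation[OF A] by blast
  qed
  define a :: "(real^'n) \<times> (real^'m)" where "a = ((\<chi> i. 1), (\<chi> j. -1))"
  have a: "a \<noteq> 0" by (auto simp: a_def zero_prod_def vec_eq_iff)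
  have sub: "f ` (b ` E) \<subseteq> {z. a \<bullet> z = 0}"
  proof (rule image_subsetI)
    fix X
    have "(\<Sum>i\<in>UNIV. \<Sum>j\<in>UNIV. X $ i $ j) = (\<Sum>j\<in>UNIV. \<Sum>i\<in>UNIV. X $ i $ j)" for X :: "real^'m^'n"
      by (rule sum.swap)
    then show "f X \<in> {z. a \<bullet> z = 0}"
      by (simp add: a_def f_def inner_Pair inner_vec_def sum_negf)
  qed
  have "card E = card (b ` E)" using injb by (simp add: card_image inj_on_subset)
  also have "\<dots> = card (f ` (b ` E))"
    using inj_on_subset[OF inj span_superset] by (simp add: card_image)
  also have "\<dots> \<le> dim {z. a \<bullet> z = 0}"
    by (rule independent_card_le_dim[OF sub linear_independent_injective_image[OF lin indep inj]])
  also have "\<dots> = CARD('n) + CARD('m) - 1" using dim_hyperplane[OF a] by simp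
  finally show ?thesis unfolding E_def .
qed

text \<open>
  There are \<open>n\<close> rows with at least two nonzero entries each, and at most
  \<open>n + (n + 1) - 1 = 2 n\<close> nonzero entries in total.
\<close>
lemma extremal_row_support_card:
  fixes A :: "real^'m^'n"
  assumes ext: "A \<in> extremal_arrays" and card: "CARD('m) = CARD('n) + 1"
  shows "card {j. A $ i $ j \<noteq> 0} = 2"
proof (rule ccontr)
  assume i: "card {j. A $ i $ j \<noteq> 0} \<noteq> 2"
  have A: "A \<in> doubly_stochastic_arrays"
    using ext by (simp add: extremal_arrays_def extreme_point_of_def)
  have ge: "2 \<le> card {j. A $ i $ j \<noteq> 0}" for i
    by (rule row_support_card_ge_2[OF A]) (use card in simp)
  have "(\<Sum>i\<in>(UNIV::'n set). 2) < (\<Sum>i\<in>UNIV. card {j. A $ i $ j \<noteq> 0})"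
    using ge i by (intro sum_strict_mono_ex1) (auto simp: le_less intro!: exI[of _ i])
  also have "\<dots> = card (SIGMA i:UNIV. {j. A $ i $ j \<noteq> 0})" by simp
  also have "(SIGMA i:UNIV. {j. A $ i $ j \<noteq> 0}) = {(i, j). A $ i $ j \<noteq> 0}" by auto
  also have "card \<dots> \<le> CARD('n) + CARD('m) - 1" by (rule extremal_support_card_le[OF ext])
  finally show False using card by simp
qed

lemma rooted_forest_attach_leaf:
  assumes p: "p \<in> rooted_forests M K" and v: "v \<notin> M \<union> K" and u: "u \<in> M \<union> K"
  shows "p(v := u) \<in> rooted_forests (insert v M) K"
  unfolding rooted_forests_def
proof (intro CollectI conjI allI impI)
  show "p(v := u) \<in> insert v M \<rightarrow>\<^sub>E insert v M \<union> K"
    using rooted_forestsD(1,3)[OF p] u by (auto simp: PiE_iff extensional_def)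
  fix S assume S: "S \<subseteq> insert v M" "(p(v := u)) ` S \<subseteq> S"
  have "S - {v} = {}"
  proof (rule rooted_forestsD(2)[OF p])
    show "p ` (S - {v}) \<subseteq> S - {v}"
    proof (rule image_subsetI)
      fix x assume x: "x \<in> S - {v}"
      then have "p x \<in> S" using S(2) by (auto simp: image_subset_iff)
      moreover have "p x \<noteq> v" using rooted_forestsD(1)[OF p, of x] x S(1) v by auto
      ultimately show "p x \<in> S - {v}" by simp
    qed
  qed (use S in auto)
  moreover have "v \<in> S \<Longrightarrow> u \<in> S - {v}" using S u v by (auto simp: image_subset_iff)
  ultimately show "S = {}" by blast
qed

text \<open>
  The tree grows from the root \<open>\<rho>\<close> by one column at a time: connectedness provides a row with one
  endpoint \<open>u\<close> in the current tree and the other endpoint \<open>v\<close> outside, and \<open>v\<close> is attached to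
  \<open>u\<close>.  This row is new, because both endpoints of a used row already belong to the tree.
\<close>
lemma grow_tree_in_support:
  fixes A :: "real^'m^'n" and \<rho> :: 'm
  assumes A: "A \<in> doubly_stochastic_arrays" and card: "CARD('m) = CARD('n) + 1"
    and two: "\<And>i. card {j. A $ i $ j \<noteq> 0} = 2" and "k \<le> CARD('n)"
  shows "\<exists>M r p. \<rho> \<notin> M \<and> card M = k \<and> inj_on r M \<and> p \<in> rooted_forests M {\<rho>} \<and>
    (\<forall>v\<in>M. {j. A $ r v $ j \<noteq> 0} = {v, p v})"
  using \<open>k \<le> CARD('n)\<close>
proof (induction k)
  case 0
  have "(\<lambda>_. undefined) \<in> rooted_forests {} {\<rho>}" by (auto simp: rooted_forests_def)
  then show ?case by (intro exI[of _ "{}"]) auto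
next
  case (Suc k)
  then obtain M r p where M: "\<rho> \<notin> M" "card M = k" and inj: "inj_on r M"
    and p: "p \<in> rooted_forests M {\<rho>}" and supp: "\<And>v. v \<in> M \<Longrightarrow> {j. A $ r v $ j \<noteq> 0} = {v, p v}"
    by auto
  have "card (insert \<rho> M) \<noteq> CARD('m)" using M Suc.prems card by simp
  then have "insert \<rho> M \<noteq> UNIV" by metis
  then obtain i u v where u: "u \<in> insert \<rho> M" and v: "v \<notin> insert \<rho> M"
    and nz: "A $ i $ u \<noteq> 0" "A $ i $ v \<noteq> 0"
    using array_connects_columns[OF A card, of "insert \<rho> M"] by blast
  have i: "i \<notin> r ` M"
  proof
    assume "i \<in> r ` M"
    then obtain w where w: "w \<in> M" "i = r w" by blast
    then have "v \<in> {w, p w}" using nz supp[of w] by blast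
    then show False using w v rooted_forestsD(1)[OF p, of w] by auto
  qed
  have new: "{j. A $ i $ j \<noteq> 0} = {v, u}"
    by (rule card_subset_eq[symmetric]) (use nz two[of i] u v in \<open>auto simp: card_insert_if\<close>)
  have "p(v := u) \<in> rooted_forests (insert v M) {\<rho>}"
    by (rule rooted_forest_attach_leaf[OF p]) (use u v in auto)
  moreover have "inj_on (r(v := i)) (insert v M)"
    using inj i v by (auto simp: inj_on_def)
  moreover have "\<forall>w\<in>insert v M. {j. A $ (r(v := i)) w $ j \<noteq> 0} = {w, (p(v := u)) w}"
    using supp new v by auto
  moreover have "\<rho> \<notin> insert v M" "card (insert v M) = Suc k" using M v by auto
  ultimately show ?case by blast
qed

section \<open>Counting\<close>

text \<open>
  Trees on the type of columns with edges labelled by rows, in the form obtained by rooting at \<open>\<rho>\<close>: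
  an edge is identified with its endpoint farther from \<open>\<rho>\<close>.  Extensionality fixes the values of both
  functions at \<open>\<rho>\<close>, so that each tree is counted once.
\<close>
definition edge_labelled_trees :: "'m \<Rightarrow> (('m \<Rightarrow> 'n) \<times> ('m \<Rightarrow> 'm)) set" where
  "edge_labelled_trees \<rho> =
     {r \<in> (- {\<rho>}) \<rightarrow>\<^sub>E UNIV. inj_on r (- {\<rho>})} \<times> rooted_forests (- {\<rho>}) {\<rho>}"

lemma edge_labelled_treesD:
  fixes \<rho> :: "'m::finite" and r :: "'m \<Rightarrow> 'n::finite"
  assumes "(r, p) \<in> edge_labelled_trees \<rho>" and card: "CARD('m) = CARD('n) + 1"
  shows "bij_betw r (- {\<rho>}) UNIV" "p \<in> rooted_forests (- {\<rho>}) {\<rho>}" "r \<in> extensional (- {\<rho>})"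
proof -
  have inj: "inj_on r (- {\<rho>})" using assms(1) by (simp add: edge_labelled_trees_def)
  have "card (- {\<rho>}) = CARD('n)" using card by (simp add: Compl_eq_Diff_UNIV card_Diff_singleton)
  then have "card (r ` (- {\<rho>})) = CARD('n)" by (simp add: card_image[OF inj])
  then have "r ` (- {\<rho>}) = UNIV" by (intro card_eq_UNIV_imp_eq_UNIV) auto
  then show "bij_betw r (- {\<rho>}) UNIV" using inj by (simp add: bij_betw_def)
qed (use assms(1) in \<open>auto simp: edge_labelled_trees_def PiE_iff\<close>)

lemma extremal_has_tree_support:
  fixes A :: "real^'m^'n" and \<rho> :: 'm
  assumes ext: "A \<in> extremal_arrays" and card: "CARD('m) = CARD('n) + 1"
  obtains r p where "(r, p) \<in> edge_labelled_trees \<rho>" "has_tree_support A \<rho> r p"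
proof -
  have A: "A \<in> doubly_stochastic_arrays"
    using ext by (simp add: extremal_arrays_def extreme_point_of_def)
  obtain M r p where M: "\<rho> \<notin> M" "card M = CARD('n)" and inj: "inj_on r M"
    and p: "p \<in> rooted_forests M {\<rho>}" and supp: "\<forall>v\<in>M. {j. A $ r v $ j \<noteq> 0} = {v, p v}"
    using grow_tree_in_support[OF A card extremal_row_support_card[OF ext card] order_refl, of \<rho>] by blast
  have "M = - {\<rho>}"
    by (rule card_subset_eq) (use M card in \<open>auto simp: Compl_eq_Diff_UNIV card_Diff_singleton\<close>)
  then have "(restrict r (- {\<rho>}), p) \<in> edge_labelled_trees \<rho>"
    using inj p by (auto simp: edge_labelled_trees_def inj_on_def)
  moreover have "has_tree_support A \<rho> (restrict r (- {\<rho>})) p"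
    using supp \<open>M = - {\<rho>}\<close> by (auto simp: has_tree_support_def)
  ultimately show thesis using that by blast
qed

text \<open>
  The map sends a tree to the unique array that it supports.
\<close>
lemma extremal_arrays_bij_edge_labelled_trees:
  fixes \<rho> :: "'m::finite"
  assumes card: "CARD('m) = CARD('n::finite) + 1"
  obtains \<Phi> where "bij_betw \<Phi> (edge_labelled_trees \<rho> :: (('m \<Rightarrow> 'n) \<times> ('m \<Rightarrow> 'm)) set)
    (extremal_arrays :: (real^'m^'n) set)"
proof -
  let ?T = "edge_labelled_trees \<rho> :: (('m \<Rightarrow> 'n) \<times> ('m \<Rightarrow> 'm)) set"
  note T = edge_labelled_treesD[OF _ card]
  have "\<forall>t\<in>?T. \<exists>A::real^'m^'n. A \<in> doubly_stochastic_arrays \<and> has_tree_support A \<rho> (fst t) (snd t)"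
  proof clarify
    fix r :: "'m \<Rightarrow> 'n" and p assume t: "(r, p) \<in> ?T"
    show "\<exists>A::real^'m^'n. A \<in> doubly_stochastic_arrays \<and> has_tree_support A \<rho> (fst (r, p)) (snd (r, p))"
      using tree_array_exists[OF T(2)[OF t] T(1)[OF t] card] by auto
  qed
  then obtain \<Phi> :: "_ \<Rightarrow> real^'m^'n" where \<Phi>:
    "\<And>r p. (r, p) \<in> ?T \<Longrightarrow> \<Phi> (r, p) \<in> doubly_stochastic_arrays \<and> has_tree_support (\<Phi> (r, p)) \<rho> r p"
    by (metis fst_conv snd_conv)
  have "inj_on \<Phi> ?T"
  proof (rule inj_onI, clarify)
    fix r p r' p' assume t: "(r, p) \<in> ?T" and t': "(r', p') \<in> ?T" and eq: "\<Phi> (r, p) = \<Phi> (r', p')"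
    have "r v = r' v \<and> p v = p' v" if "v \<noteq> \<rho>" for v
      by (rule tree_determined_by_support[OF T(2,1)[OF t] T(2,1)[OF t'], of "\<Phi> (r, p)"])
         (use \<Phi>[OF t] \<Phi>[OF t'] eq that in auto)
    then have "r = r'" "p = p'"
      using T(3)[OF t] T(3)[OF t'] rooted_forestsD(3)[OF T(2)[OF t]] rooted_forestsD(3)[OF T(2)[OF t']]
      by (auto intro: extensionalityI)
    then show "r = r' \<and> p = p'" by simp
  qed
  moreover have "\<Phi> ` ?T = extremal_arrays"
  proof (intro subset_antisym image_subsetI subsetI)
    fix t assume "t \<in> ?T"
    then show "\<Phi> t \<in> extremal_arrays"
      using tree_supported_extremal[OF T(2,1)] \<Phi> by (cases t) blast
  next
    fix A :: "real^'m^'n" assume A: "A \<in> extremal_arrays"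
    then obtain r p where t: "(r, p) \<in> ?T" and S: "has_tree_support A \<rho> r p"
      using extremal_has_tree_support[OF A card] by blast
    have "A \<in> doubly_stochastic_arrays"
      using A by (simp add: extremal_arrays_def extreme_point_of_def)
    then have "A = \<Phi> (r, p)"
      using tree_supported_array_unique[OF T(2,1)[OF t]] S \<Phi>[OF t] by blast
    then show "A \<in> \<Phi> ` ?T" using t by blast
  qed
  ultimately show thesis using that unfolding bij_betw_def by blast
qed

lemma card_edge_labelled_trees:
  fixes \<rho> :: "'m::finite"
  assumes card: "CARD('m) = CARD('n::finite) + 1"
  shows "card (edge_labelled_trees \<rho> :: (('m \<Rightarrow> 'n) \<times> ('m \<Rightarrow> 'm)) set)
    = fact CARD('n) * (CARD('n) + 1) ^ (CARD('n) - 1)"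
proof -
  have cM: "card (- {\<rho>}) = CARD('n)"
    using card by (simp add: Compl_eq_Diff_UNIV card_Diff_singleton)
  then have ne: "- {\<rho>} \<noteq> {}" by (metis card.empty zero_less_card_finite less_irrefl)
  have "card {r \<in> (- {\<rho>}) \<rightarrow>\<^sub>E (UNIV :: 'n set). inj_on r (- {\<rho>})}
      = (\<Prod>i = 0..<CARD('n). CARD('n) - i)"
    using card_inj_on_subset_funcset[of "- {\<rho>}" "UNIV :: 'n set" "- {\<rho>}"] cM by simp
  also have "\<dots> = fact CARD('n)" by (simp add: fact_prod_rev)
  finally have "card {r \<in> (- {\<rho>}) \<rightarrow>\<^sub>E (UNIV :: 'n set). inj_on r (- {\<rho>})} = fact CARD('n)" .
  moreover have "card (rooted_forests (- {\<rho>}) {\<rho>}) = (CARD('n) + 1) ^ (CARD('n) - 1)"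
    using card_rooted_forests[of "- {\<rho>}" "{\<rho>}"] ne cM by simp
  ultimately show ?thesis unfolding edge_labelled_trees_def by (simp add: card_cartesian_product)
qed

theorem theorem1p5:
  fixes n :: nat
  assumes "0 < n"
    and "CARD('n::finite) = n"
    and "CARD('m::finite) = n + 1"
  shows "finite (extremal_arrays :: (real ^ 'm ^ 'n) set)
    \<and> card (extremal_arrays :: (real ^ 'm ^ 'n) set) = fact n * (n + 1) ^ (n - 1)"
proof -
  have card: "CARD('m) = CARD('n) + 1" using assms(2,3) by simp
  obtain \<rho> :: 'm where "\<rho> \<in> UNIV" by blast
  obtain \<Phi> where "bij_betw \<Phi> (edge_labelled_trees \<rho> :: (('m \<Rightarrow> 'n) \<times> ('m \<Rightarrow> 'm)) set)
      (extremal_arrays :: (real^'m^'n) set)"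
    using extremal_arrays_bij_edge_labelled_trees[OF card] by blast
  then have eq: "card (extremal_arrays :: (real^'m^'n) set) = fact n * (n + 1) ^ (n - 1)"
    using card_edge_labelled_trees[OF card, of \<rho>] assms(2) by (simp add: bij_betw_same_card[symmetric])
  moreover have "0 < fact n * (n + 1) ^ (n - 1)" by simp
  ultimately show ?thesis by (metis card_ge_0_finite)
qed

end
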